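(* Let $L>0$, let $I=[0,T)$ with $0<T\le\infty$, and let $u_0\in X_1$. Suppose that $u$ and $r$ are functions of $t\in I$ with $u(\cdot,t)\in X_1$ and $r(\cdot,t)\in X_2$ for all $t\in I$, with $u(\cdot,0)=u_0$, such that for every $t\in I$ and for all $v_1\in X_2$ and $v_2\in X_1$, $$\left(u_{xt},v_1\right)=-\frac12\left(u r_x+(ur)_x,\,v_1\right),$$ $$\left(r,(v_2)_x\right)=\left(u_x,(v_2)_x\right).$$ Assume that $u_t\in X_1$ (for every $t\in I$). Then $$\frac{\mathrm{d}}{\mathrm{d}t}\mathcal{H}_1(u)=0 .$$
   Context: All functions are real-valued. $H^1(-L,L)$ is the usual first-order Sobolev space on $(-L,L)$ and $$X_1=\{v\in H^1(-L,L)\mid v(-L)=0\},\qquad X_2=\{v\in H^1(-L,L)\mid v(L)=0\}.$$ The bracket is $(f,g)=\int_{-L}^{L} f g\,\mathrm{d}x$. Subscripts $x$ and $t$ denote differentiation in space and in time; the time derivative $u_t$ is the derivative of $t\mapsto u(\cdot,t)$ as an $X_1$-valued map (with the $H^1$ norm), and $u_{xt}=(u_t)_x$. The energy (first Hamiltonian) is $$\mathcal{H}_1(u)=\frac12\int_{-L}^{L}u_x^2\,\mathrm{d}x .$$ The system is an $H^1$-weak form of the once-integrated Hunter--Saxton equation $(u_t+uu_x)_x-\frac12u_x^2=0$ on $(-L,L)$, with $r$ playing the role of $u_x$. *)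

theory Defs
  imports "HOL-Analysis.Analysis"
begin

text \<open>
  Elements of $L^2(-L,L)$ and $H^1(-L,L)$ are represented by functions on the reals, of which only
  the almost-everywhere class on $(-L,L)$ matters.
\<close>

abbreviation leb_interval :: "real \<Rightarrow> real measure" where
  "leb_interval L \<equiv> lebesgue_on {-L<..<L}"

definition L2_space :: "real \<Rightarrow> (real \<Rightarrow> real) set" where
  "L2_space L = {f. f \<in> borel_measurable (leb_interval L) \<and>
                    integrable (leb_interval L) (\<lambda>x. (f x)\<^sup>2)}"

definition bracket :: "real \<Rightarrow> (real \<Rightarrow> real) \<Rightarrow> (real \<Rightarrow> real) \<Rightarrow> real" where
  "bracket L f g = (\<integral>x. f x * g x \<partial>leb_interval L)"

definition test_functions :: "real \<Rightarrow> (real \<Rightarrow> real) set" where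
  "test_functions L = {\<phi>. (\<forall>k x. (deriv ^^ k) \<phi> differentiable (at x)) \<and>
                          (\<exists>K. compact K \<and> K \<subseteq> {-L<..<L} \<and> (\<forall>x. x \<notin> K \<longrightarrow> \<phi> x = 0))}"

definition has_weak_deriv :: "real \<Rightarrow> (real \<Rightarrow> real) \<Rightarrow> (real \<Rightarrow> real) \<Rightarrow> bool" where
  "has_weak_deriv L f g \<longleftrightarrow> (\<forall>\<phi>\<in>test_functions L. bracket L f (deriv \<phi>) = - bracket L g \<phi>)"

definition H1_space :: "real \<Rightarrow> (real \<Rightarrow> real) set" where
  "H1_space L = {f \<in> L2_space L. \<exists>g\<in>L2_space L. has_weak_deriv L f g}"

text \<open>
  The weak derivative is unique only up to null sets; for a function in $H^1$ the choice below
  picks some representative of it.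
\<close>

definition weak_deriv :: "real \<Rightarrow> (real \<Rightarrow> real) \<Rightarrow> real \<Rightarrow> real" where
  "weak_deriv L f = (SOME g. g \<in> L2_space L \<and> has_weak_deriv L f g)"

definition H1_norm :: "real \<Rightarrow> (real \<Rightarrow> real) \<Rightarrow> real" where
  "H1_norm L f = sqrt (bracket L f f + bracket L (weak_deriv L f) (weak_deriv L f))"

text \<open>
  Point values of an $H^1$ function at the end points of the interval are those of its
  representative that is continuous on $[-L,L]$ (which is unique there for \<open>L > 0\<close>).
\<close>

definition has_boundary_value :: "real \<Rightarrow> (real \<Rightarrow> real) \<Rightarrow> real \<Rightarrow> real \<Rightarrow> bool" where
  "has_boundary_value L f a y \<longleftrightarrow>
     (\<exists>c. continuous_on {-L..L} c \<and> (AE x in leb_interval L. c x = f x) \<and> c a = y)"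

definition X1 :: "real \<Rightarrow> (real \<Rightarrow> real) set" where
  "X1 L = {v \<in> H1_space L. has_boundary_value L v (-L) 0}"

definition X2 :: "real \<Rightarrow> (real \<Rightarrow> real) set" where
  "X2 L = {v \<in> H1_space L. has_boundary_value L v L 0}"

text \<open>
  Differentiability of a curve $t \mapsto u(t)$ in the $H^1$ norm, relative to a set of times
  (so one-sided at an end point belonging to that set).
\<close>

definition has_H1_time_deriv ::
  "real \<Rightarrow> (real \<Rightarrow> real \<Rightarrow> real) \<Rightarrow> (real \<Rightarrow> real) \<Rightarrow> real \<Rightarrow> real set \<Rightarrow> bool" where
  "has_H1_time_deriv L u w t I \<longleftrightarrow>
     ((\<lambda>s. H1_norm L (\<lambda>x. (u s x - u t x) / (s - t) - w x)) \<longlongrightarrow> 0) (at t within I)"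

definition energy1 :: "real \<Rightarrow> (real \<Rightarrow> real) \<Rightarrow> real" where
  "energy1 L v = 1 / 2 * (\<integral>x. (weak_deriv L v x)\<^sup>2 \<partial>leb_interval L)"

end

theory Submission
  imports Defs "HOL-Real_Asymp.Real_Asymp"
begin

text \<open>
  The derivative of the energy along the flow is the bracket of \<open>u\<^sub>x\<close> with \<open>u\<^sub>x\<^sub>t\<close>. Testing the second
  equation with \<open>u\<^sub>t\<close> replaces \<open>u\<^sub>x\<close> by \<open>r\<close> in it, and testing the first equation with \<open>r\<close>, which is
  an admissible test function, turns the result into minus one half of the integral of
  \<open>u r\<^sub>x r + (u r)\<^sub>x r\<close>. This integrand is the derivative of \<open>u r\<^sup>2\<close>, and \<open>u r\<^sup>2\<close> vanishes at both ends of
  the interval, since \<open>u\<close> is zero at the left end and \<open>r\<close> at the right end.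
  
  The chain rule for the energy (\<open>energy1_has_derivative\<close>) and the vanishing of the boundary terms
  (\<open>convective_term_cancels\<close>) both rest on one-dimensional Sobolev theory. Weak derivatives are unique
  almost everywhere, because an integrable function orthogonal to all test functions vanishes
  (\<open>AE_zero_if_orthogonal_test_functions\<close>); it follows that the chosen weak derivative is linear up to
  null sets. A function with weak derivative zero is constant (\<open>AE_const_if_weak_deriv_zero\<close>), so every
  function in \<open>H\<^sup>1\<close> is almost everywhere the cumulative integral of its weak derivative
  (\<open>H1_AE_eq_primitive\<close>), and that representative carries the boundary values. For cumulative integrals
  the product rule is a consequence of Fubini's theorem (\<open>primitive_mult\<close>); it is used three times, to
  show that cumulative integrals have their densities as weak derivatives, to differentiate \<open>u r\<close>, and to
  integrate the derivative of \<open>u r\<^sup>2\<close>.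
\<close>

section \<open>Smooth functions and cutoffs\<close>

definition smooth :: "(real \<Rightarrow> real) \<Rightarrow> bool" where
  "smooth f \<longleftrightarrow> (\<forall>k x. (deriv ^^ k) f differentiable (at x))"

text \<open>
  Iterated derivatives of a concrete function rarely have a usable closed form. Membership in a set of
  differentiable functions that is closed under differentiation avoids computing them.
\<close>
lemma smooth_coinduct:
  assumes "f \<in> S" and "\<And>g x. g \<in> S \<Longrightarrow> g differentiable (at x)"
    and "\<And>g. g \<in> S \<Longrightarrow> deriv g \<in> S"
  shows "smooth f"
proof -
  have "(deriv ^^ k) f \<in> S" for k
    by (induction k) (use assms in auto)
  then show ?thesis
    using assms(2) by (auto simp: smooth_def)
qed

lemma smooth_deriv: "smooth f \<Longrightarrow> smooth (deriv f)"
  unfolding smooth_def by (metis comp_apply funpow_Suc_right)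

lemma smooth_has_deriv:
  assumes "smooth f" shows "(f has_real_derivative deriv f x) (at x)"
proof -
  have "f differentiable (at x)"
    using assms unfolding smooth_def by (metis funpow_0)
  then show ?thesis
    using DERIV_deriv_iff_real_differentiable by blast
qed

lemma smooth_continuous_on: "smooth f \<Longrightarrow> continuous_on A f"
  by (meson DERIV_isCont continuous_at_imp_continuous_on smooth_has_deriv)

lemma smooth_antideriv:
  assumes F: "\<And>x. (F has_real_derivative f x) (at x)" and f: "smooth f"
  shows "smooth F"
proof -
  have "deriv F = f"
    using F by (auto intro: DERIV_imp_deriv)
  have "(deriv ^^ k) F differentiable (at x)" for k x
  proof (cases k)
    case 0
    then show ?thesis using F real_differentiable_def by auto
  next
    case (Suc m)
    then show ?thesis
      using f \<open>deriv F = f\<close> unfolding smooth_def by (simp add: funpow_swap1)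
  qed
  then show ?thesis by (simp add: smooth_def)
qed

text \<open>
  The product of two smooth functions is smooth because the Leibniz rule never leaves the set below;
  the set of single products would not be closed under differentiation.
\<close>
inductive_set sums_of_products :: "(real \<Rightarrow> real) set" where
  prod: "smooth f \<Longrightarrow> smooth g \<Longrightarrow> (\<lambda>x. f x * g x) \<in> sums_of_products"
| sum: "f \<in> sums_of_products \<Longrightarrow> g \<in> sums_of_products \<Longrightarrow> (\<lambda>x. f x + g x) \<in> sums_of_products"

lemma sums_of_products_deriv:
  assumes "f \<in> sums_of_products"
  shows "\<exists>f'\<in>sums_of_products. \<forall>x. (f has_real_derivative f' x) (at x)"
  using assms
proof induction
  case (prod f g)
  have "(\<lambda>x. f x * deriv g x + deriv f x * g x) \<in> sums_of_products"
    by (intro sums_of_products.intros prod smooth_deriv)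
  moreover have "((\<lambda>x. f x * g x) has_real_derivative f x * deriv g x + deriv f x * g x) (at x)" for x
    by (rule DERIV_mult'; rule smooth_has_deriv; fact)
  ultimately show ?case by (intro bexI allI)
next
  case (sum f g)
  then obtain f' g' where "f' \<in> sums_of_products" "\<And>x. (f has_real_derivative f' x) (at x)"
    "g' \<in> sums_of_products" "\<And>x. (g has_real_derivative g' x) (at x)"
    by blast
  then show ?case
    by (intro bexI[of _ "\<lambda>x. f' x + g' x"]) (auto intro: DERIV_add sums_of_products.sum)
qed

lemma smooth_of_sums_of_products:
  assumes "f \<in> sums_of_products" shows "smooth f"
proof (rule smooth_coinduct[OF assms])
  fix g x assume "g \<in> sums_of_products"
  then obtain g' where g': "g' \<in> sums_of_products" "\<And>x. (g has_real_derivative g' x) (at x)"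
    using sums_of_products_deriv by blast
  then show "g differentiable (at x)" using real_differentiable_def by blast
  have "deriv g = g'" using g' by (auto intro: DERIV_imp_deriv)
  then show "deriv g \<in> sums_of_products" using g' by simp
qed

lemma smooth_mult: "smooth f \<Longrightarrow> smooth g \<Longrightarrow> smooth (\<lambda>x. f x * g x)"
  by (rule smooth_of_sums_of_products[OF sums_of_products.prod])

lemma smooth_const: "smooth (\<lambda>x. c)"
  by (rule smooth_coinduct[of _ "range (\<lambda>c x. c)"]) auto

lemma smooth_add:
  assumes "smooth f" "smooth g" shows "smooth (\<lambda>x. f x + g x)"
proof -
  \<comment> \<open>The factors one turn a sum into a sum of products.\<close>
  have "(\<lambda>x. f x * 1 + g x * 1) \<in> sums_of_products"
    by (intro sums_of_products.sum sums_of_products.prod assms smooth_const)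
  then show ?thesis
    using smooth_of_sums_of_products by fastforce
qed

lemma smooth_affine:
  assumes "smooth f" shows "smooth (\<lambda>x. f (a * x + b))"
proof -
  have D: "((\<lambda>x. c * f (a * x + b)) has_real_derivative (c * a) * deriv f (a * x + b)) (at x)"
    if "smooth f" for c f x
    by (rule derivative_eq_intros DERIV_chain2[OF smooth_has_deriv[OF that]] refl | simp)+
  \<comment> \<open>The free factor \<open>c\<close> absorbs the powers of \<open>a\<close> that the chain rule produces.\<close>
  have "smooth (\<lambda>x. 1 * f (a * x + b))"
  proof (rule smooth_coinduct[where S = "{\<lambda>x. c * f (a * x + b) |c f. smooth f}"])
    fix g x assume "g \<in> {\<lambda>x. c * f (a * x + b) |c f. smooth f}"
    then obtain c f where g: "g = (\<lambda>x. c * f (a * x + b))" and f: "smooth f" by blast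
    show "g differentiable (at x)"
      unfolding g using D[OF f] real_differentiable_def by blast
    have "deriv g = (\<lambda>x. (c * a) * deriv f (a * x + b))"
      unfolding g using D[OF f] by (auto intro: DERIV_imp_deriv)
    then show "deriv g \<in> {\<lambda>x. c * f (a * x + b) |c f. smooth f}"
      using smooth_deriv[OF f] by blast
  qed (use assms in blast)
  then show ?thesis by simp
qed

text \<open>
  Every derivative of \<open>exp (- 1 / x)\<close>, extended by zero to the left half-line, is this function times a
  polynomial in \<open>1 / x\<close>, so this family is closed under differentiation. The extension is differentiable
  at the origin because exponential decay beats every power of \<open>1 / x\<close>.
\<close>
definition poly_flat :: "real poly \<Rightarrow> real \<Rightarrow> real" where
  "poly_flat p x = (if x > 0 then poly p (1 / x) * exp (- 1 / x) else 0)"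

lemma poly_times_exp_tendsto_0: "((\<lambda>z. poly p z * exp (- z)) \<longlongrightarrow> 0) (at_top :: real filter)"
proof -
  have "((\<lambda>z. \<Sum>i\<le>degree p. coeff p i * (z ^ i * exp (- z))) \<longlongrightarrow> (\<Sum>i\<le>degree p. coeff p i * 0))
      (at_top :: real filter)"
    by (intro tendsto_intros)
      (use tendsto_power_div_exp_0 in \<open>auto simp: exp_minus field_simps\<close>)
  then show ?thesis
    by (simp add: poly_altdef sum_distrib_left sum_distrib_right mult_ac)
qed

lemma poly_flat_deriv:
  "(poly_flat p has_real_derivative poly_flat ([:0, 0, 1:] * (p - pderiv p)) x) (at x)"
proof (cases x "0 :: real" rule: linorder_cases)
  case less
  have "((\<lambda>x. 0) has_real_derivative poly_flat ([:0, 0, 1:] * (p - pderiv p)) x) (at x)"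
    using less by (simp add: poly_flat_def)
  then show ?thesis
    by (rule has_field_derivative_transform_within_open[where S = "{..<0}"])
      (use less in \<open>auto simp: poly_flat_def\<close>)
next
  case greater
  have inner: "((\<lambda>x. 1 / x) has_real_derivative - (1 / x\<^sup>2)) (at x)"
    "((\<lambda>x. - 1 / x) has_real_derivative 1 / x\<^sup>2) (at x)"
    using greater by (auto intro!: derivative_eq_intros simp: power2_eq_square)
  have "((\<lambda>x. poly p (1 / x) * exp (- 1 / x)) has_real_derivative
      poly p (1 / x) * (exp (- 1 / x) * (1 / x\<^sup>2))
        + poly (pderiv p) (1 / x) * (- (1 / x\<^sup>2)) * exp (- 1 / x)) (at x)"
    by (intro DERIV_mult' DERIV_chain2[OF poly_DERIV] DERIV_chain2[OF DERIV_exp] inner)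
  moreover have "poly p (1 / x) * (exp (- 1 / x) * (1 / x\<^sup>2))
        + poly (pderiv p) (1 / x) * (- (1 / x\<^sup>2)) * exp (- 1 / x)
      = poly_flat ([:0, 0, 1:] * (p - pderiv p)) x"
    using greater by (simp add: poly_flat_def power2_eq_square algebra_simps)
  ultimately have "((\<lambda>x. poly p (1 / x) * exp (- 1 / x)) has_real_derivative
      poly_flat ([:0, 0, 1:] * (p - pderiv p)) x) (at x)" by (simp only:)
  then show ?thesis
    by (rule has_field_derivative_transform_within_open[where S = "{0<..}"])
      (use greater in \<open>auto simp: poly_flat_def\<close>)
next
  case equal
  have "((\<lambda>h. poly ([:0, 1:] * p) (1 / h) * exp (- (1 / h))) \<longlongrightarrow> 0) (at_right 0)"
    by (rule filterlim_compose[OF poly_times_exp_tendsto_0]) real_asymp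
  have ev: "eventually (\<lambda>h::real. h > 0) (at_right 0)"
    by (rule eventually_at_right_less)
  have "((\<lambda>h. poly_flat p h / h) \<longlongrightarrow> 0) (at_right 0)"
    by (rule Lim_transform_eventually[OF \<open>((\<lambda>h. poly ([:0, 1:] * p) (1 / h) * exp (- (1 / h))) \<longlongrightarrow> 0) (at_right 0)\<close>])
      (use ev in \<open>auto simp: poly_flat_def elim!: eventually_mono\<close>)
  moreover have "((\<lambda>h. poly_flat p h / h) \<longlongrightarrow> 0) (at_left 0)"
  proof (rule tendsto_eventually)
    show "\<forall>\<^sub>F h in at_left 0. poly_flat p h / h = 0"
      using eventually_at_left_real[of "-1" "0::real"]
      by (auto simp: poly_flat_def elim!: eventually_mono)
  qed
  ultimately have "((\<lambda>h. poly_flat p h / h) \<longlongrightarrow> 0) (at 0)"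
    by (simp add: filterlim_split_at)
  then show ?thesis
    using equal by (simp add: DERIV_def poly_flat_def)
qed

definition flat :: "real \<Rightarrow> real" where
  "flat x = (if x > 0 then exp (- 1 / x) else 0)"

lemma smooth_flat: "smooth flat"
proof (rule smooth_coinduct[where S = "range poly_flat"])
  show "flat \<in> range poly_flat"
    by (rule image_eqI[of _ _ 1]) (auto simp: flat_def poly_flat_def)
  fix g x assume "g \<in> range poly_flat"
  then obtain p where g: "g = poly_flat p" by blast
  show "g differentiable (at x)"
    unfolding g using poly_flat_deriv real_differentiable_def by blast
  have "deriv g = poly_flat ([:0, 0, 1:] * (p - pderiv p))"
    unfolding g using poly_flat_deriv by (auto intro: DERIV_imp_deriv)
  then show "deriv g \<in> range poly_flat" by simp
qed

lemma flat_bounds: "0 \<le> flat x" "flat x \<le> 1" by (auto simp: flat_def)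

lemma flat_tendsto_1: "(flat \<longlongrightarrow> 1) at_top"
proof -
  have "((\<lambda>x::real. exp (- 1 / x)) \<longlongrightarrow> 1) at_top" by real_asymp
  then show ?thesis
    by (rule Lim_transform_eventually) (auto simp: flat_def intro!: eventually_mono[OF eventually_gt_at_top[of 0]])
qed

lemma test_functions_iff:
  "\<phi> \<in> test_functions L \<longleftrightarrow> smooth \<phi> \<and> (\<exists>K. compact K \<and> K \<subseteq> {-L<..<L} \<and> (\<forall>x. x \<notin> K \<longrightarrow> \<phi> x = 0))"
  by (simp add: test_functions_def smooth_def)

text \<open>
  The cutoffs converge to the indicator of the part of the interval to the left of \<open>x\<close>. The shifts
  by one keep the support a distance \<open>1 / Suc n\<close> inside the interval, and \<open>min\<close> makes every real \<open>x\<close>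
  admissible; in particular \<open>x = L\<close> exhausts the whole interval.
\<close>
definition cutoff :: "real \<Rightarrow> real \<Rightarrow> nat \<Rightarrow> real \<Rightarrow> real" where
  "cutoff L x n y = flat (real (Suc n) * (y + L) - 1) * flat (real (Suc n) * (min x L - y) - 1)"

lemma cutoff_test: "cutoff L x n \<in> test_functions L"
  unfolding test_functions_iff
proof (intro conjI exI)
  let ?n = "real (Suc n)"
  have "smooth (\<lambda>y. flat (?n * y + (?n * L - 1)) * flat ((- ?n) * y + (?n * min x L - 1)))"
    by (intro smooth_mult smooth_affine smooth_flat)
  moreover have "cutoff L x n = (\<lambda>y. flat (?n * y + (?n * L - 1)) * flat ((- ?n) * y + (?n * min x L - 1)))"
    by (auto simp: cutoff_def fun_eq_iff algebra_simps)
  ultimately show "smooth (cutoff L x n)" by simp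
  show "compact {-L + 1 / ?n .. min x L - 1 / ?n}" by simp
  show "{-L + 1 / ?n .. min x L - 1 / ?n} \<subseteq> {-L<..<L}"
  proof
    fix y assume "y \<in> {-L + 1 / ?n .. min x L - 1 / ?n}"
    moreover have "1 / ?n > 0" by simp
    ultimately show "y \<in> {-L<..<L}" unfolding atLeastAtMost_iff greaterThanLessThan_iff by linarith
  qed
  show "\<forall>y. y \<notin> {-L + 1 / ?n .. min x L - 1 / ?n} \<longrightarrow> cutoff L x n y = 0"
    by (auto simp: cutoff_def flat_def field_simps simp del: min_less_iff_conj)
qed

lemma cutoff_bound: "\<bar>cutoff L x n y\<bar> \<le> 1"
  unfolding cutoff_def abs_mult using flat_bounds
  by (simp add: mult_le_one)

lemma cutoff_tendsto:
  assumes "-L < y" "y < L"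
  shows "(\<lambda>n. cutoff L x n y) \<longlonglongrightarrow> indicator {..<x} y"
proof -
  have pos: "(\<lambda>n. flat (real (Suc n) * a - 1)) \<longlonglongrightarrow> 1" if "a > 0" for a
    by (rule filterlim_compose[OF flat_tendsto_1]) (use that in real_asymp)
  show ?thesis
  proof (cases "y < x")
    case True
    then have "(\<lambda>n. cutoff L x n y) \<longlonglongrightarrow> 1 * 1"
      unfolding cutoff_def using assms by (intro tendsto_mult pos) auto
    then show ?thesis using True by simp
  next
    case False
    then have "real (Suc n) * (min x L - y) - 1 \<le> 0" for n
      using mult_nonneg_nonpos[of "real (Suc n)" "min x L - y"] by linarith
    then have "flat (real (Suc n) * (min x L - y) - 1) = 0" for n
      by (simp add: flat_def not_less)
    then have "cutoff L x n y = 0" for n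
      unfolding cutoff_def by (simp only: mult_zero_right)
    then show ?thesis using False by simp
  qed
qed

section \<open>Functions orthogonal to all test functions\<close>

lemma borel_measurable_leb_interval:
  fixes f :: "real \<Rightarrow> real"
  assumes "f \<in> borel_measurable borel"
  shows "f \<in> borel_measurable (leb_interval L)"
  using assms by (intro measurable_restrict_space1 measurable_completion) simp

lemma finite_measure_leb_interval: "finite_measure (leb_interval L)"
  by (rule finite_measure_lebesgue_on) (simp flip: box_real)

lemma AE_leb_interval_neq: "AE y in leb_interval L. y \<noteq> x"
proof -
  have "AE y in lebesgue. y \<noteq> x"
    by (rule AE_completion[OF AE_lborel_singleton])
  then show ?thesis
    by (subst AE_restrict_space_iff) (auto elim: eventually_mono)
qed

lemma indicator_mult_integrable:
  fixes f :: "real \<Rightarrow> real"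
  assumes "integrable (leb_interval L) f" "A \<in> sets borel"
  shows "integrable (leb_interval L) (\<lambda>y. indicator A y * f y)"
proof (rule Bochner_Integration.integrable_bound[OF assms(1)])
  show "(\<lambda>y. indicator A y * f y) \<in> borel_measurable (leb_interval L)"
    using assms(2) borel_measurable_integrable[OF assms(1)]
    by (intro borel_measurable_times borel_measurable_leb_interval[OF borel_measurable_indicator])
qed (auto simp: indicator_def)

text \<open>
  The half-lines generate the Borel sets and are closed under intersection, so the integral of \<open>f\<close>
  vanishes over every Borel set by Dynkin's argument, and over every Lebesgue set because such a set
  is Borel up to a null set.
\<close>
lemma AE_zero_if_cumulative_zero:
  fixes f :: "real \<Rightarrow> real"
  assumes f: "integrable (leb_interval L) f"
    and cum: "\<And>x. (\<integral>y. indicator {..<x} y * f y \<partial>leb_interval L) = 0"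
  shows "AE y in leb_interval L. f y = 0"
proof -
  let ?M = "leb_interval L"
  interpret finite_measure ?M by (rule finite_measure_leb_interval)
  have total: "integral\<^sup>L ?M f = 0"
  proof -
    have "integral\<^sup>L ?M f = (\<integral>y. indicator {..<L} y * f y \<partial>?M)"
      by (rule Bochner_Integration.integral_cong) auto
    then show ?thesis using cum by simp
  qed
  have borel: "(\<integral>y. indicator A y * f y \<partial>?M) = 0" if "A \<in> sets borel" for A
  proof -
    have "Int_stable (range (lessThan :: real \<Rightarrow> _))"
      by (auto simp: Int_stable_def image_iff intro: exI[of _ "min _ _"])
    moreover have "range (lessThan :: real \<Rightarrow> _) \<subseteq> Pow UNIV"
      by simp
    moreover have "A \<in> sigma_sets UNIV (range lessThan)"
      using that by (simp add: borel_Iio)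
    ultimately show ?thesis
    proof (induction rule: sigma_sets_induct_disjoint)
      fix A assume "A \<in> range (lessThan :: real \<Rightarrow> _)"
      then show "(\<integral>y. indicator A y * f y \<partial>?M) = 0" using cum by auto
    next
      fix A :: "real set"
      assume A: "A \<in> sigma_sets UNIV (range lessThan)"
        and 0: "(\<integral>y. indicator A y * f y \<partial>?M) = 0"
      have "A \<in> sets borel" using A by (simp add: borel_Iio)
      have "(\<integral>y. indicator (UNIV - A) y * f y \<partial>?M) = (\<integral>y. f y - indicator A y * f y \<partial>?M)"
        by (rule Bochner_Integration.integral_cong) (auto simp: indicator_def)
      also have "\<dots> = 0"
        using f \<open>A \<in> sets borel\<close> total 0
        by (simp add: indicator_mult_integrable)
      finally show "(\<integral>y. indicator (UNIV - A) y * f y \<partial>?M) = 0" .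
    next
      fix A :: "nat \<Rightarrow> real set"
      assume disj: "disjoint_family A" and A: "range A \<subseteq> sigma_sets UNIV (range lessThan)"
        and 0: "\<And>i. (\<integral>y. indicator (A i) y * f y \<partial>?M) = 0"
      have borel_A: "A i \<in> sets borel" for i using A by (auto simp: borel_Iio)
      define B where "B i = A i \<inter> {-L<..<L}" for i
      have B: "B i \<in> sets ?M" for i
        using borel_A by (auto simp: B_def sets_restrict_space_iff)
      have on_B: "set_lebesgue_integral ?M (B i) f = (\<integral>y. indicator (A i) y * f y \<partial>?M)" for i
        unfolding set_lebesgue_integral_def
        by (rule Bochner_Integration.integral_cong) (auto simp: B_def indicator_def)
      have "(\<integral>y. indicator (\<Union>i. A i) y * f y \<partial>?M) = set_lebesgue_integral ?M (\<Union>i. B i) f"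
        unfolding set_lebesgue_integral_def
        by (rule Bochner_Integration.integral_cong) (auto simp: B_def indicator_def)
      also have "\<dots> = (\<Sum>i. set_lebesgue_integral ?M (B i) f)"
      proof (rule lebesgue_integral_countable_add[OF B])
        show "B i \<inter> B j = {}" if "i \<noteq> j" for i j
          using disj that by (auto simp: B_def disjoint_family_on_def)
        show "set_integrable ?M (\<Union>i. B i) f"
          unfolding set_integrable_def using B f by (intro integrable_mult_indicator) auto
      qed
      also have "\<dots> = 0" using 0 on_B by simp
      finally show "(\<integral>y. indicator (\<Union>i. A i) y * f y \<partial>?M) = 0" .
    qed auto
  qed
  show ?thesis
  proof (rule density_zero[OF f])
    fix A assume "A \<in> sets ?M"
    then have A: "A \<in> sets lebesgue" by (simp add: sets_restrict_space_iff)
    have "AE y in lebesgue. y \<in> main_part lborel A \<longleftrightarrow> y \<in> A"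
      by (rule AE_completion[OF AE_in_main_part]) (use A in simp)
    then have "AE y in ?M. y \<in> main_part lborel A \<longleftrightarrow> y \<in> A"
      by (subst AE_restrict_space_iff) (auto elim: eventually_mono)
    then have "AE y in ?M. indicator A y *\<^sub>R f y = indicator (main_part lborel A) y * f y"
      by (rule eventually_mono) (auto simp: indicator_def)
    moreover have "main_part lborel A \<in> sets borel"
      using main_part_sets[OF A] by simp
    ultimately show "set_lebesgue_integral ?M A f = 0"
      unfolding set_lebesgue_integral_def
      using \<open>A \<in> sets ?M\<close> f borel
      by (subst integral_cong_AE[where g = "\<lambda>y. indicator (main_part lborel A) y * f y"])
        (auto intro!: borel_measurable_integrable indicator_mult_integrable integrable_mult_indicator[of A ?M f, simplified])
  qed
qed

lemma deriv_test_function: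
  assumes "\<phi> \<in> test_functions L" shows "deriv \<phi> \<in> test_functions L"
proof -
  obtain K where K: "compact K" "K \<subseteq> {-L<..<L}" "\<And>x. x \<notin> K \<Longrightarrow> \<phi> x = 0" and sm: "smooth \<phi>"
    using assms by (auto simp: test_functions_iff)
  have "deriv \<phi> x = 0" if "x \<notin> K" for x
  proof (rule DERIV_imp_deriv)
    have "((\<lambda>x. 0) has_real_derivative 0) (at x)" by simp
    then show "(\<phi> has_real_derivative 0) (at x)"
      by (rule has_field_derivative_transform_within_open[where S = "- K"])
        (use K that in \<open>auto simp: compact_imp_closed\<close>)
  qed
  then show ?thesis
    using K sm by (auto simp: test_functions_iff smooth_deriv)
qed

lemma test_function_measurable:
  "\<phi> \<in> test_functions L \<Longrightarrow> \<phi> \<in> borel_measurable (leb_interval L)"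
  by (intro borel_measurable_leb_interval borel_measurable_continuous_onI)
    (auto simp: test_functions_iff smooth_continuous_on)

lemma test_function_bounded:
  assumes "\<phi> \<in> test_functions L" obtains B where "\<And>x. \<bar>\<phi> x\<bar> \<le> B"
proof -
  obtain K where K: "compact K" "\<And>x. x \<notin> K \<Longrightarrow> \<phi> x = 0" and sm: "smooth \<phi>"
    using assms by (auto simp: test_functions_iff)
  have "bounded (\<phi> ` K)"
    using K sm by (intro compact_imp_bounded compact_continuous_image smooth_continuous_on)
  then obtain B where B: "\<And>x. x \<in> K \<Longrightarrow> \<bar>\<phi> x\<bar> \<le> B"
    by (auto simp: bounded_iff)
  have "\<bar>\<phi> x\<bar> \<le> max B 0" for x
    using B[of x] K(2)[of x] by (cases "x \<in> K") auto
  then show thesis by (rule that)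
qed

lemma integrable_mult_bounded:
  fixes f g :: "real \<Rightarrow> real"
  assumes f: "integrable M f" and g: "g \<in> borel_measurable M"
    and B: "\<And>x. x \<in> space M \<Longrightarrow> \<bar>g x\<bar> \<le> B"
  shows "integrable M (\<lambda>x. f x * g x)"
proof (rule Bochner_Integration.integrable_bound)
  show "integrable M (\<lambda>x. B * f x)" using f by simp
  show "AE x in M. norm (f x * g x) \<le> norm (B * f x)"
  proof (rule AE_I2)
    fix x assume x: "x \<in> space M"
    have "\<bar>f x\<bar> * \<bar>g x\<bar> \<le> \<bar>f x\<bar> * \<bar>B\<bar>"
      using B[OF x] by (intro mult_left_mono) auto
    then show "norm (f x * g x) \<le> norm (B * f x)" by (simp add: abs_mult mult.commute)
  qed
qed (use f g in auto)

lemma integrable_mult_test_function: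
  assumes "integrable (leb_interval L) f" "\<phi> \<in> test_functions L"
  shows "integrable (leb_interval L) (\<lambda>x. f x * \<phi> x)"
  using test_function_bounded[OF assms(2)] integrable_mult_bounded test_function_measurable assms
  by metis

lemma test_function_integrable:
  assumes "\<phi> \<in> test_functions L" shows "integrable (leb_interval L) \<phi>"
proof -
  interpret finite_measure "leb_interval L" by (rule finite_measure_leb_interval)
  show ?thesis
    using integrable_mult_test_function[of L "\<lambda>_. 1", OF _ assms] by simp
qed

lemma integral_cutoff_tendsto:
  assumes f: "integrable (leb_interval L) f"
  shows "(\<lambda>n. bracket L f (cutoff L x n)) \<longlonglongrightarrow> (\<integral>y. indicator {..<x} y * f y \<partial>leb_interval L)"
  unfolding bracket_def
proof (rule integral_dominated_convergence[where w = "\<lambda>y. \<bar>f y\<bar>"])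
  show "AE y in leb_interval L. (\<lambda>n. f y * cutoff L x n y) \<longlonglongrightarrow> indicator {..<x} y * f y"
    by (rule AE_I2) (auto simp: mult.commute[of "f _"] intro!: tendsto_mult_right cutoff_tendsto)
  show "AE y in leb_interval L. norm (f y * cutoff L x n y) \<le> \<bar>f y\<bar>" for n
    using cutoff_bound by (intro AE_I2) (simp add: abs_mult mult_left_le)
  show "(\<lambda>y. indicator {..<x} y * f y) \<in> borel_measurable (leb_interval L)"
    by (rule borel_measurable_integrable[OF indicator_mult_integrable[OF f]]) simp
  show "(\<lambda>y. f y * cutoff L x n y) \<in> borel_measurable (leb_interval L)" for n
    by (rule borel_measurable_integrable[OF integrable_mult_test_function[OF f cutoff_test]])
qed (use f in simp)

text \<open>
  The fundamental lemma of the calculus of variations. The cutoffs are bounded by one, so dominated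
  convergence transfers orthogonality from them to indicators of half-lines.
\<close>
lemma AE_zero_if_orthogonal_test_functions:
  assumes f: "integrable (leb_interval L) f"
    and orth: "\<And>\<phi>. \<phi> \<in> test_functions L \<Longrightarrow> bracket L f \<phi> = 0"
  shows "AE x in leb_interval L. f x = 0"
proof (rule AE_zero_if_cumulative_zero[OF f])
  fix x
  show "(\<integral>y. indicator {..<x} y * f y \<partial>leb_interval L) = 0"
    using integral_cutoff_tendsto[OF f, of x] orth[OF cutoff_test]
    by (simp add: LIMSEQ_const_iff)
qed

section \<open>Absolutely continuous functions\<close>

text \<open>
  Cumulative integrals with integrable density are exactly the absolutely continuous functions on the
  closed interval. The measure lives on \<open>{-L<..<L}\<close>, so the function is automatically
  constant outside the interval, with value \<open>c\<close> at and to the left of \<open>-L\<close>.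
\<close>
definition primitive :: "real \<Rightarrow> real \<Rightarrow> (real \<Rightarrow> real) \<Rightarrow> real \<Rightarrow> real" where
  "primitive L c g x = c + (\<integral>y. indicator {..<x} y * g y \<partial>leb_interval L)"

lemma primitive_left: "x \<le> -L \<Longrightarrow> primitive L c g x = c"
  unfolding primitive_def
  by (subst Bochner_Integration.integral_cong[where g = "\<lambda>_. 0", OF refl]) auto

lemma primitive_right: "L \<le> x \<Longrightarrow> primitive L c g x = c + integral\<^sup>L (leb_interval L) g"
  unfolding primitive_def
  by (subst Bochner_Integration.integral_cong[where g = g, OF refl]) auto

lemma primitive_truncate:
  "y \<le> x \<Longrightarrow> primitive L c (\<lambda>z. indicator {..<x} z * g z) y = primitive L c g y"
  unfolding primitive_def
  by (intro arg_cong2[where f = "(+)"] refl Bochner_Integration.integral_cong)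
    (auto simp: indicator_def)

lemma primitive_bounded:
  assumes g: "integrable (leb_interval L) g"
  shows "\<bar>primitive L c g x\<bar> \<le> \<bar>c\<bar> + (\<integral>y. \<bar>g y\<bar> \<partial>leb_interval L)"
proof -
  have "\<bar>\<integral>y. indicator {..<x} y * g y \<partial>leb_interval L\<bar>
      \<le> (\<integral>y. \<bar>indicator {..<x} y * g y\<bar> \<partial>leb_interval L)"
    by (rule integral_abs_bound)
  also have "\<dots> \<le> (\<integral>y. \<bar>g y\<bar> \<partial>leb_interval L)"
    by (intro integral_mono integrable_abs indicator_mult_integrable g) (auto simp: indicator_def)
  finally show ?thesis unfolding primitive_def by linarith
qed

lemma primitive_continuous:
  assumes g: "integrable (leb_interval L) g"
  shows "continuous_on A (primitive L c g)"
proof (rule continuous_at_imp_continuous_on, intro ballI)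
  fix x
  show "isCont (primitive L c g) x"
  proof (rule continuous_within_sequentiallyI)
    fix u :: "nat \<Rightarrow> real" assume u: "u \<longlonglongrightarrow> x"
    have "(\<lambda>n. \<integral>y. indicator {..<u n} y * g y \<partial>leb_interval L)
        \<longlonglongrightarrow> (\<integral>y. indicator {..<x} y * g y \<partial>leb_interval L)"
    proof (rule integral_dominated_convergence[where w = "\<lambda>y. \<bar>g y\<bar>"])
      show "AE y in leb_interval L. (\<lambda>n. indicator {..<u n} y * g y) \<longlonglongrightarrow> indicator {..<x} y * g y"
        using AE_leb_interval_neq[of x L]
      proof (rule eventually_mono)
        fix y assume "y \<noteq> x"
        have "\<forall>\<^sub>F n in sequentially. indicator {..<u n} y * g y = indicator {..<x} y * g y"
        proof (cases "y < x")
          case True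
          show ?thesis
            using order_tendstoD(1)[OF u True] by (rule eventually_mono) (simp add: True)
        next
          case False
          then have "\<forall>\<^sub>F n in sequentially. u n < y"
            using order_tendstoD(2)[OF u, of y] \<open>y \<noteq> x\<close> by auto
          then show ?thesis using False by (auto elim: eventually_mono)
        qed
        then show "(\<lambda>n. indicator {..<u n} y * g y) \<longlonglongrightarrow> indicator {..<x} y * g y"
          by (rule tendsto_eventually)
      qed
      show "AE y in leb_interval L. norm (indicator {..<u n} y * g y) \<le> \<bar>g y\<bar>" for n
        by (rule AE_I2) (auto simp: indicator_def)
    qed (use g in \<open>auto intro: borel_measurable_integrable[OF indicator_mult_integrable[OF g]]\<close>)
    then show "(\<lambda>n. primitive L c g (u n)) \<longlonglongrightarrow> primitive L c g x"
      unfolding primitive_def by (intro tendsto_intros)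
  qed
qed

lemma primitive_measurable:
  assumes "integrable (leb_interval L) g"
  shows "primitive L c g \<in> borel_measurable (leb_interval L)"
  by (intro borel_measurable_leb_interval borel_measurable_continuous_onI primitive_continuous assms)

lemma integrable_mult_primitive:
  assumes "integrable (leb_interval L) f" "integrable (leb_interval L) g"
  shows "integrable (leb_interval L) (\<lambda>x. f x * primitive L c g x)"
  by (rule integrable_mult_bounded[OF assms(1) primitive_measurable[OF assms(2)]
      primitive_bounded[OF assms(2)]])

text \<open>
  Integration by parts in its symmetric form: the square with sides \<open>{-L<..<L}\<close> is cut along the
  diagonal, which is a null set, and Fubini's theorem integrates over the two triangles in the order
  in which the inner integral is a cumulative one.
\<close>
lemma integral_mult_integral_eq:
  assumes g: "integrable (leb_interval L) g" and k: "integrable (leb_interval L) k"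
  shows "integral\<^sup>L (leb_interval L) g * integral\<^sup>L (leb_interval L) k
    = (\<integral>y. g y * primitive L 0 k y + primitive L 0 g y * k y \<partial>leb_interval L)"
proof -
  let ?M = "leb_interval L"
  interpret M: finite_measure ?M by (rule finite_measure_leb_interval)
  interpret MM: pair_sigma_finite ?M ?M ..
  note [measurable] = borel_measurable_integrable[OF g] borel_measurable_integrable[OF k]
  have [measurable]: "(\<lambda>y. y) \<in> borel_measurable ?M"
    by (rule borel_measurable_leb_interval) simp
  define h where "h y z = (if y < z then 1 else 0) * (g y * k z)" for y z :: real
  have h_meas [measurable]: "case_prod h \<in> borel_measurable (?M \<Otimes>\<^sub>M ?M)"
    unfolding h_def by measurable
  have h_bound: "norm (h y z) \<le> \<bar>g y\<bar> * \<bar>k z\<bar>" for y z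
    by (auto simp: h_def abs_mult)
  have h_int: "integrable ?M (h y)" for y
  proof (rule Bochner_Integration.integrable_bound)
    show "integrable ?M (\<lambda>z. g y * k z)" using k by simp
    show "h y \<in> borel_measurable ?M" unfolding h_def by measurable
  qed (auto simp: h_def)
  have "integrable (?M \<Otimes>\<^sub>M ?M) (case_prod h)"
  proof (rule MM.Fubini_integrable)
    show "integrable ?M (\<lambda>y. \<integral>z. norm (case (y, z) of (y, z) \<Rightarrow> h y z) \<partial>?M)"
    proof (rule Bochner_Integration.integrable_bound)
      show "integrable ?M (\<lambda>y. g y * (\<integral>z. \<bar>k z\<bar> \<partial>?M))" using g by simp
      show "(\<lambda>y. \<integral>z. norm (case (y, z) of (y, z) \<Rightarrow> h y z) \<partial>?M) \<in> borel_measurable ?M"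
        by measurable
      have "(\<integral>z. norm (h y z) \<partial>?M) \<le> (\<integral>z. \<bar>g y\<bar> * \<bar>k z\<bar> \<partial>?M)" for y
        using h_bound h_int k by (intro integral_mono) auto
      then show "AE y in ?M. norm (\<integral>z. norm (case (y, z) of (y, z) \<Rightarrow> h y z) \<partial>?M)
          \<le> norm (g y * (\<integral>z. \<bar>k z\<bar> \<partial>?M))"
        by (intro AE_I2) (simp add: abs_mult)
    qed
    show "AE y in ?M. integrable ?M (\<lambda>z. case (y, z) of (y, z) \<Rightarrow> h y z)"
      using h_int by simp
  qed measurable
  then have swap: "(\<integral>z. (\<integral>y. h y z \<partial>?M) \<partial>?M) = (\<integral>y. (\<integral>z. h y z \<partial>?M) \<partial>?M)"
    and int_h: "integrable ?M (\<lambda>y. \<integral>z. h y z \<partial>?M)"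
    using MM.Fubini_integral[of h] MM.integrable_fst[of h] by auto
  have inner: "(\<integral>y. h y z \<partial>?M) = primitive L 0 g z * k z" for z
  proof -
    have "(\<integral>y. h y z \<partial>?M) = (\<integral>y. (indicator {..<z} y * g y) * k z \<partial>?M)"
      by (rule Bochner_Integration.integral_cong) (auto simp: h_def indicator_def)
    then show ?thesis by (simp add: primitive_def)
  qed
  \<comment> \<open>The diagonal point \<open>z = y\<close> belongs to neither triangle, hence equality only almost everywhere.\<close>
  have split: "g y * integral\<^sup>L ?M k = g y * primitive L 0 k y + (\<integral>z. h y z \<partial>?M)" for y
  proof -
    have "(\<integral>z. g y * k z \<partial>?M) = (\<integral>z. g y * (indicator {..<y} z * k z) + h y z \<partial>?M)"
      using AE_leb_interval_neq[of y L]
      by (intro integral_cong_AE)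
        (auto simp: h_def indicator_def elim!: eventually_mono)
    also have "\<dots> = (\<integral>z. g y * (indicator {..<y} z * k z) \<partial>?M) + (\<integral>z. h y z \<partial>?M)"
      by (intro Bochner_Integration.integral_add h_int integrable_mult_right
          indicator_mult_integrable k) simp
    finally show ?thesis by (simp add: primitive_def)
  qed
  have "integral\<^sup>L ?M g * integral\<^sup>L ?M k = (\<integral>y. g y * integral\<^sup>L ?M k \<partial>?M)"
    by simp
  also have "\<dots> = (\<integral>y. g y * primitive L 0 k y \<partial>?M) + (\<integral>z. primitive L 0 g z * k z \<partial>?M)"
    unfolding split
    by (subst Bochner_Integration.integral_add[OF integrable_mult_primitive[OF g k] int_h])
      (simp flip: swap add: inner)
  also have "\<dots> = (\<integral>y. g y * primitive L 0 k y + primitive L 0 g y * k y \<partial>?M)"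
    using integrable_mult_primitive[OF g k] integrable_mult_primitive[OF k g]
    by (subst Bochner_Integration.integral_add) (auto simp: mult.commute)
  finally show ?thesis .
qed

lemma product_rule_integrable:
  assumes g: "integrable (leb_interval L) g" and k: "integrable (leb_interval L) k"
  shows "integrable (leb_interval L) (\<lambda>y. g y * primitive L d k y + primitive L c g y * k y)"
  using integrable_mult_primitive[OF g k] integrable_mult_primitive[OF k g]
  by (intro Bochner_Integration.integrable_add) (simp_all add: mult.commute)

text \<open>
  The product rule for absolutely continuous functions. Truncating both densities at \<open>x\<close> reduces it to
  integration by parts over the whole interval. Smooth functions need not be treated separately: a
  test function is itself a cumulative integral.
\<close>
lemma primitive_mult:
  assumes g: "integrable (leb_interval L) g" and k: "integrable (leb_interval L) k"
  shows "primitive L c g x * primitive L d k x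
    = primitive L (c * d) (\<lambda>y. g y * primitive L d k y + primitive L c g y * k y) x"
proof -
  let ?M = "leb_interval L" and ?t = "\<lambda>f y. indicator {..<x} y * f y :: real"
  have gt: "integrable ?M (?t g)" and kt: "integrable ?M (?t k)"
    by (intro indicator_mult_integrable g k; simp)+
  have shift: "primitive L e f y = e + primitive L 0 f y" for e f y
    by (simp add: primitive_def)
  have "integral\<^sup>L ?M (?t g) * integral\<^sup>L ?M (?t k)
      = (\<integral>y. ?t g y * primitive L 0 (?t k) y + primitive L 0 (?t g) y * ?t k y \<partial>?M)"
    by (rule integral_mult_integral_eq[OF gt kt])
  also have "\<dots> = (\<integral>y. ?t (\<lambda>y. g y * primitive L 0 k y + primitive L 0 g y * k y) y \<partial>?M)"
    by (rule Bochner_Integration.integral_cong, rule refl)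
      (use primitive_truncate[of _ x L 0] in \<open>auto split: split_indicator\<close>)
  finally have prod: "integral\<^sup>L ?M (?t g) * integral\<^sup>L ?M (?t k) = \<dots>" .
  have "(\<integral>y. ?t (\<lambda>y. g y * primitive L d k y + primitive L c g y * k y) y \<partial>?M)
      = (\<integral>y. d * ?t g y + c * ?t k y
          + ?t (\<lambda>y. g y * primitive L 0 k y + primitive L 0 g y * k y) y \<partial>?M)"
    unfolding shift[of d] shift[of c]
    by (rule Bochner_Integration.integral_cong) (auto simp: algebra_simps)
  also have "\<dots> = d * integral\<^sup>L ?M (?t g) + c * integral\<^sup>L ?M (?t k)
      + integral\<^sup>L ?M (?t g) * integral\<^sup>L ?M (?t k)"
    unfolding prod
    using gt kt indicator_mult_integrable[OF product_rule_integrable[OF g k], of "{..<x}" 0 0]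
    by (subst Bochner_Integration.integral_add Bochner_Integration.integral_add)+ auto
  finally show ?thesis
    by (simp add: primitive_def algebra_simps)
qed

section \<open>Test functions and weak derivatives of absolutely continuous functions\<close>

lemma integral_leb_interval_FTC:
  assumes F: "\<And>x. (F has_real_derivative f x) (at x)" and f: "continuous_on UNIV f"
    and x: "-L \<le> x" "x \<le> L"
  shows "(\<integral>y. indicator {..<x} y * f y \<partial>leb_interval L) = F x - F (-L)"
proof -
  have [measurable]: "f \<in> borel_measurable borel"
    by (rule borel_measurable_continuous_onI[OF f])
  have "(\<integral>y. indicator {..<x} y * f y \<partial>leb_interval L)
      = (\<integral>y. indicator {-L<..<L} y *\<^sub>R (indicator {..<x} y * f y) \<partial>lebesgue)"
    by (rule integral_restrict_space) simp
  also have "\<dots> = (\<integral>y. indicator {-L<..<L} y *\<^sub>R (indicator {..<x} y * f y) \<partial>lborel)"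
    by (rule integral_completion) measurable
  also have "\<dots> = (\<integral>y. f y * indicator {-L..x} y \<partial>lborel)"
  proof (rule integral_cong_AE)
    show "AE y in lborel. indicator {-L<..<L} y *\<^sub>R (indicator {..<x} y * f y) = f y * indicator {-L..x} y"
      using AE_lborel_singleton[of x] AE_lborel_singleton[of "-L"]
      by eventually_elim (use x in \<open>auto simp: indicator_def\<close>)
  qed measurable
  also have "\<dots> = F x - F (-L)"
    using f by (intro integral_FTC_Icc_real x F) (auto simp: continuous_on_eq_continuous_at)
  finally show ?thesis .
qed

lemma test_function_support:
  assumes "\<phi> \<in> test_functions L" "L > 0"
  obtains a b where "-L < a" "a < b" "b < L" "\<And>x. x \<le> a \<Longrightarrow> \<phi> x = 0" "\<And>x. b \<le> x \<Longrightarrow> \<phi> x = 0"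
proof -
  obtain K where K: "compact K" "K \<subseteq> {-L<..<L}" "\<And>x. x \<notin> K \<Longrightarrow> \<phi> x = 0"
    using assms by (auto simp: test_functions_iff)
  have "compact (insert 0 K)" using K(1) by simp
  moreover have "insert 0 K \<noteq> {}" by simp
  ultimately obtain s t where s: "s \<in> insert 0 K" "\<And>x. x \<in> insert 0 K \<Longrightarrow> s \<le> x"
    and t: "t \<in> insert 0 K" "\<And>x. x \<in> insert 0 K \<Longrightarrow> x \<le> t"
    using compact_attains_inf[of "insert 0 K"] compact_attains_sup[of "insert 0 K"] by metis
  have "-L < s" "t < L" "s \<le> t" using s t K(2) assms(2) by auto
  show thesis
  proof
    \<comment> \<open>Midpoints between the support and the ends of the interval lie strictly outside the support.\<close>
    show "-L < (s - L) / 2" "(t + L) / 2 < L" "(s - L) / 2 < (t + L) / 2"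
      using \<open>-L < s\<close> \<open>t < L\<close> \<open>s \<le> t\<close> assms(2) by auto
    show "\<phi> x = 0" if "x \<le> (s - L) / 2" for x
      using s(2)[of x] that \<open>-L < s\<close> by (intro K(3)) auto
    show "\<phi> x = 0" if "(t + L) / 2 \<le> x" for x
      using t(2)[of x] that \<open>t < L\<close> by (intro K(3)) auto
  qed
qed

lemma test_functionI:
  assumes "smooth \<phi>" "-L < a" "b < L" "\<And>x. x \<le> a \<Longrightarrow> \<phi> x = 0" "\<And>x. b \<le> x \<Longrightarrow> \<phi> x = 0"
  shows "\<phi> \<in> test_functions L"
  unfolding test_functions_iff
  using assms by (intro conjI exI[of _ "{a..b}"]) auto

lemma test_function_eq_primitive:
  assumes "\<phi> \<in> test_functions L" "L > 0" "-L \<le> x" "x \<le> L"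
  shows "primitive L 0 (deriv \<phi>) x = \<phi> x"
proof -
  obtain a where "-L < a" "\<And>x. x \<le> a \<Longrightarrow> \<phi> x = 0"
    using test_function_support[OF assms(1,2)] by metis
  then have "\<phi> (-L) = 0" by simp
  have sm: "smooth \<phi>" using assms by (simp add: test_functions_iff)
  show ?thesis
    unfolding primitive_def
    using integral_leb_interval_FTC[OF smooth_has_deriv[OF sm]
        smooth_continuous_on[OF smooth_deriv[OF sm]] assms(3,4)] \<open>\<phi> (-L) = 0\<close>
    by simp
qed

text \<open>
  A test function vanishes at \<open>L\<close>, so the product rule with it has no boundary term.
\<close>
lemma primitive_has_weak_deriv:
  assumes g: "integrable (leb_interval L) g" and L: "L > 0"
  shows "has_weak_deriv L (primitive L c g) g"
  unfolding has_weak_deriv_def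
proof
  fix \<phi> assume \<phi>: "\<phi> \<in> test_functions L"
  let ?M = "leb_interval L"
  have \<phi>': "integrable ?M (deriv \<phi>)"
    by (intro test_function_integrable deriv_test_function \<phi>)
  obtain b where "b < L" "\<And>x. b \<le> x \<Longrightarrow> \<phi> x = 0"
    using test_function_support[OF \<phi> L] by metis
  then have "\<phi> L = 0" by simp
  then have "primitive L 0 (deriv \<phi>) L = 0"
    using test_function_eq_primitive[OF \<phi> L, of L] L by simp
  then have "0 = primitive L c g L * primitive L 0 (deriv \<phi>) L" by simp
  also have "\<dots> = (\<integral>y. g y * primitive L 0 (deriv \<phi>) y + primitive L c g y * deriv \<phi> y \<partial>?M)"
    unfolding primitive_mult[OF g \<phi>'] by (simp add: primitive_right)
  also have "\<dots> = (\<integral>y. g y * \<phi> y + primitive L c g y * deriv \<phi> y \<partial>?M)"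
    by (rule Bochner_Integration.integral_cong)
      (use test_function_eq_primitive[OF \<phi> L] in auto)
  also have "\<dots> = bracket L g \<phi> + bracket L (primitive L c g) (deriv \<phi>)"
    unfolding bracket_def
    using integrable_mult_test_function[OF g \<phi>] integrable_mult_primitive[OF \<phi>' g]
    by (intro Bochner_Integration.integral_add) (simp_all add: mult.commute)
  finally show "bracket L (primitive L c g) (deriv \<phi>) = - bracket L g \<phi>" by simp
qed

text \<open>
  An antiderivative is constant on each side of the support of \<open>\<eta>\<close>; the vanishing integral makes the two
  constants agree, so subtracting their common value leaves a compactly supported function.
\<close>
lemma test_function_antideriv:
  assumes L: "L > 0" and \<eta>: "\<eta> \<in> test_functions L" and zero: "integral\<^sup>L (leb_interval L) \<eta> = 0"
  obtains \<phi> where "\<phi> \<in> test_functions L" "deriv \<phi> = \<eta>"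
proof -
  have sm: "smooth \<eta>" using \<eta> by (simp add: test_functions_iff)
  have cont: "continuous_on A \<eta>" for A by (rule smooth_continuous_on[OF sm])
  then have isCont: "isCont \<eta> x" for x
    using continuous_on_eq_continuous_at[of UNIV] by auto
  have "\<exists>F. \<forall>x. -\<infinity> < ereal x \<longrightarrow> ereal x < \<infinity> \<longrightarrow> (F has_vector_derivative \<eta> x) (at x)"
    by (rule einterval_antiderivative) (auto intro: isCont)
  then obtain F where F: "\<And>x. (F has_real_derivative \<eta> x) (at x)"
    by (auto simp: has_real_derivative_iff_has_vector_derivative)
  obtain a b where ab: "-L < a" "a < b" "b < L"
    and \<eta>0: "\<And>x. x \<le> a \<Longrightarrow> \<eta> x = 0" "\<And>x. b \<le> x \<Longrightarrow> \<eta> x = 0"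
    using test_function_support[OF \<eta> L] by metis
  have const: "F v = F u" if "u \<le> v" "\<And>x. u \<le> x \<Longrightarrow> x \<le> v \<Longrightarrow> \<eta> x = 0" for u v
  proof -
    have "F v - F u = (\<integral>x. \<eta> x * indicator {u..v} x \<partial>lborel)"
      using that(1) F isCont by (intro integral_FTC_Icc_real[symmetric]) auto
    also have "\<dots> = integral\<^sup>L lborel (\<lambda>x::real. 0)"
      by (rule Bochner_Integration.integral_cong) (use that(2) in \<open>auto simp: indicator_def\<close>)
    finally show ?thesis by simp
  qed
  have "(\<integral>y. indicator {..<L} y * \<eta> y \<partial>leb_interval L) = integral\<^sup>L (leb_interval L) \<eta>"
    by (rule Bochner_Integration.integral_cong) auto
  then have "F L = F (-L)"
    using integral_leb_interval_FTC[OF F cont, of L L] L zero by simp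
  define \<phi> where "\<phi> x = F x - F (-L)" for x
  have \<phi>': "(\<phi> has_real_derivative \<eta> x) (at x)" for x
    unfolding \<phi>_def using F[of x] by (auto intro!: derivative_eq_intros)
  show thesis
  proof
    show "deriv \<phi> = \<eta>" using \<phi>' by (auto intro: DERIV_imp_deriv)
    show "\<phi> \<in> test_functions L"
    proof (rule test_functionI[OF smooth_antideriv[OF \<phi>' sm] ab(1,3)])
      show "\<phi> x = 0" if "x \<le> a" for x
        using const[of x a] const[of "-L" a] that ab \<eta>0 by (simp add: \<phi>_def)
      show "\<phi> x = 0" if "b \<le> x" for x
        using const[of b x] const[of b L] that ab \<eta>0 \<open>F L = F (-L)\<close> by (simp add: \<phi>_def)
    qed
  qed
qed

lemma test_functions_combination:
  assumes "L > 0" "\<phi> \<in> test_functions L" "\<psi> \<in> test_functions L"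
  shows "(\<lambda>x. a * \<phi> x + b * \<psi> x) \<in> test_functions L"
proof -
  obtain p q where p: "-L < p" "q < L" "\<And>x. x \<le> p \<Longrightarrow> \<phi> x = 0" "\<And>x. q \<le> x \<Longrightarrow> \<phi> x = 0"
    using test_function_support[OF assms(2,1)] by metis
  obtain r s where r: "-L < r" "s < L" "\<And>x. x \<le> r \<Longrightarrow> \<psi> x = 0" "\<And>x. s \<le> x \<Longrightarrow> \<psi> x = 0"
    using test_function_support[OF assms(3,1)] by metis
  show ?thesis
  proof (rule test_functionI[of _ _ "min p r" "max q s"])
    show "smooth (\<lambda>x. a * \<phi> x + b * \<psi> x)"
      using assms by (intro smooth_add smooth_mult smooth_const) (auto simp: test_functions_iff)
  qed (use p r in auto)
qed

text \<open>
  The lemma of du Bois-Reymond. For test functions \<open>\<phi>\<close> and \<open>\<psi>\<close>, the combination that gives \<open>\<phi>\<close> the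
  integral of \<open>\<psi>\<close> as weight, and \<open>\<psi>\<close> minus the integral of \<open>\<phi>\<close>, has integral zero. It is therefore the
  derivative of a test function and orthogonal to \<open>f\<close>. Letting \<open>\<psi>\<close> exhaust the interval shows that \<open>f\<close>
  minus its mean value is orthogonal to every test function.
\<close>
lemma AE_const_if_weak_deriv_zero:
  assumes L: "L > 0" and f: "integrable (leb_interval L) f"
    and weak: "has_weak_deriv L f (\<lambda>_. 0)"
  obtains c where "AE x in leb_interval L. f x = c"
proof -
  let ?M = "leb_interval L"
  interpret finite_measure ?M by (rule finite_measure_leb_interval)
  define I where "I \<psi> = integral\<^sup>L ?M \<psi>" for \<psi> :: "real \<Rightarrow> real"
  \<comment> \<open>Linear functionals vanishing on the kernel of the integral are proportional to it.\<close>
  have cross: "I \<psi> * bracket L f \<phi> = I \<phi> * bracket L f \<psi>"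
    if \<phi>: "\<phi> \<in> test_functions L" and \<psi>: "\<psi> \<in> test_functions L" for \<phi> \<psi>
  proof -
    define \<eta> where "\<eta> x = I \<psi> * \<phi> x + (- I \<phi>) * \<psi> x" for x
    have \<eta>: "\<eta> \<in> test_functions L"
      unfolding \<eta>_def[abs_def] by (rule test_functions_combination[OF L \<phi> \<psi>])
    have "integral\<^sup>L ?M \<eta> = 0"
      unfolding \<eta>_def using test_function_integrable[OF \<phi>] test_function_integrable[OF \<psi>]
      by (simp add: I_def)
    then obtain \<theta> where "\<theta> \<in> test_functions L" "deriv \<theta> = \<eta>"
      using test_function_antideriv[OF L \<eta>] by blast
    then have "bracket L f \<eta> = 0"
      using weak by (auto simp: has_weak_deriv_def bracket_def)
    moreover have "bracket L f \<eta> = (\<integral>x. I \<psi> * (f x * \<phi> x) - I \<phi> * (f x * \<psi> x) \<partial>?M)"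
      unfolding bracket_def \<eta>_def by (simp add: algebra_simps)
    moreover have "\<dots> = I \<psi> * bracket L f \<phi> - I \<phi> * bracket L f \<psi>"
      unfolding bracket_def
      using integrable_mult_test_function[OF f \<phi>] integrable_mult_test_function[OF f \<psi>] by simp
    ultimately show ?thesis by simp
  qed
  have full: "(\<integral>y. indicator {..<L} y * g y \<partial>?M) = I g" for g
    unfolding I_def by (rule Bochner_Integration.integral_cong) auto
  define m where "m = I (\<lambda>_. 1)"
  have "m = measure ?M {-L<..<L}" by (simp add: m_def I_def)
  also have "\<dots> = 2 * L" using L by (subst measure_restrict_space) auto
  finally have "m > 0" using L by simp
  have const: "m * bracket L f \<phi> = I \<phi> * I f" if \<phi>: "\<phi> \<in> test_functions L" for \<phi>
  proof (rule LIMSEQ_unique)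
    have "(\<lambda>n. bracket L (\<lambda>_. 1) (cutoff L L n)) \<longlonglongrightarrow> m"
      using integral_cutoff_tendsto[of L "\<lambda>_. 1" L] full[of "\<lambda>_. 1"] by (simp add: m_def)
    then have "(\<lambda>n. I (cutoff L L n)) \<longlonglongrightarrow> m" by (simp add: bracket_def I_def)
    then show "(\<lambda>n. I (cutoff L L n) * bracket L f \<phi>) \<longlonglongrightarrow> m * bracket L f \<phi>"
      by (rule tendsto_mult_right)
    have "(\<lambda>n. bracket L f (cutoff L L n)) \<longlonglongrightarrow> I f"
      using integral_cutoff_tendsto[OF f, of L] full[of f] by simp
    then show "(\<lambda>n. I (cutoff L L n) * bracket L f \<phi>) \<longlonglongrightarrow> I \<phi> * I f"
      unfolding cross[OF \<phi> cutoff_test] by (rule tendsto_mult_left)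
  qed
  have "AE x in ?M. f x - I f / m = 0"
  proof (rule AE_zero_if_orthogonal_test_functions)
    show "integrable ?M (\<lambda>x. f x - I f / m)" using f by simp
    fix \<phi> assume \<phi>: "\<phi> \<in> test_functions L"
    have "bracket L (\<lambda>x. f x - I f / m) \<phi> = bracket L f \<phi> - I f / m * I \<phi>"
      unfolding bracket_def left_diff_distrib
      using integrable_mult_test_function[OF f \<phi>] test_function_integrable[OF \<phi>] by (simp add: I_def)
    also have "\<dots> = 0" using const[OF \<phi>] \<open>m > 0\<close> by (simp add: field_simps)
    finally show "bracket L (\<lambda>x. f x - I f / m) \<phi> = 0" .
  qed
  then have "AE x in ?M. f x = I f / m" by simp
  then show thesis by (rule that)
qed

section \<open>Square-integrable functions\<close>

lemma L2_mult_integrable: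
  assumes "f \<in> L2_space L" "g \<in> L2_space L"
  shows "integrable (leb_interval L) (\<lambda>x. f x * g x)"
proof (rule Bochner_Integration.integrable_bound)
  show "integrable (leb_interval L) (\<lambda>x. (f x)\<^sup>2 + (g x)\<^sup>2)"
    using assms by (simp add: L2_space_def)
  have "\<bar>a * b\<bar> \<le> a\<^sup>2 + b\<^sup>2" for a b :: real
  proof -
    have "2 * (\<bar>a\<bar> * \<bar>b\<bar>) \<le> a\<^sup>2 + b\<^sup>2"
      using sum_squares_bound[of "\<bar>a\<bar>" "\<bar>b\<bar>"] by simp
    moreover have "0 \<le> \<bar>a\<bar> * \<bar>b\<bar>" by simp
    ultimately show ?thesis unfolding abs_mult by linarith
  qed
  then show "AE x in leb_interval L. norm (f x * g x) \<le> norm ((f x)\<^sup>2 + (g x)\<^sup>2)"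
    by (intro AE_I2) simp
qed (use assms in \<open>auto simp: L2_space_def\<close>)

lemma L2_bounded_mult:
  assumes f: "f \<in> L2_space L" and g: "g \<in> borel_measurable (leb_interval L)"
    and B: "\<And>x. \<bar>g x\<bar> \<le> B"
  shows "(\<lambda>x. f x * g x) \<in> L2_space L"
proof -
  have "\<bar>(g x)\<^sup>2\<bar> \<le> B\<^sup>2" for x
    using power_mono[OF B[of x], of 2] by simp
  then have "integrable (leb_interval L) (\<lambda>x. (f x)\<^sup>2 * (g x)\<^sup>2)"
    using f g by (intro integrable_mult_bounded) (auto simp: L2_space_def)
  then show ?thesis
    using f g by (simp add: L2_space_def power_mult_distrib borel_measurable_times)
qed

lemma L2_lin:
  assumes "f \<in> L2_space L" "g \<in> L2_space L"
  shows "(\<lambda>x. a * f x + b * g x) \<in> L2_space L"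
proof -
  have "(\<lambda>x. (a * f x + b * g x)\<^sup>2)
      = (\<lambda>x. a\<^sup>2 * (f x)\<^sup>2 + 2 * a * b * (f x * g x) + b\<^sup>2 * (g x)\<^sup>2)"
    by (auto simp: fun_eq_iff power2_eq_square algebra_simps)
  then show ?thesis
    using assms L2_mult_integrable[OF assms]
    by (simp add: L2_space_def borel_measurable_add borel_measurable_times)
qed

lemma L2_const: "(\<lambda>_. c) \<in> L2_space L"
proof -
  interpret finite_measure "leb_interval L" by (rule finite_measure_leb_interval)
  show ?thesis by (simp add: L2_space_def)
qed

lemma L2_integrable: "f \<in> L2_space L \<Longrightarrow> integrable (leb_interval L) f"
  using L2_mult_integrable[OF _ L2_const[of 1]] by simp

lemma L2_primitive: "g \<in> L2_space L \<Longrightarrow> primitive L c g \<in> L2_space L"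
  using L2_bounded_mult[OF L2_const[of 1] primitive_measurable primitive_bounded]
  by (simp add: L2_integrable)

lemma test_function_L2: "\<phi> \<in> test_functions L \<Longrightarrow> \<phi> \<in> L2_space L"
  using integrable_mult_test_function[OF test_function_integrable]
  by (simp add: L2_space_def test_function_measurable power2_eq_square)

lemma L2_cong_AE:
  assumes "f \<in> borel_measurable (leb_interval L)" "g \<in> L2_space L" "AE x in leb_interval L. f x = g x"
  shows "f \<in> L2_space L"
proof -
  have "integrable (leb_interval L) (\<lambda>x. (f x)\<^sup>2) \<longleftrightarrow> integrable (leb_interval L) (\<lambda>x. (g x)\<^sup>2)"
    using assms by (intro integrable_cong_AE) (auto simp: L2_space_def)
  then show ?thesis using assms by (simp add: L2_space_def)
qed

lemma L2_measurable: "f \<in> L2_space L \<Longrightarrow> f \<in> borel_measurable (leb_interval L)"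
  by (simp add: L2_space_def)

lemma bracket_lin_left:
  assumes "f \<in> L2_space L" "g \<in> L2_space L" "h \<in> L2_space L"
  shows "bracket L (\<lambda>x. a * f x + b * g x) h = a * bracket L f h + b * bracket L g h"
proof -
  have "bracket L (\<lambda>x. a * f x + b * g x) h
      = (\<integral>x. a * (f x * h x) + b * (g x * h x) \<partial>leb_interval L)"
    unfolding bracket_def by (simp add: algebra_simps)
  then show ?thesis
    using assms by (simp add: bracket_def L2_mult_integrable)
qed

lemma bracket_sym: "bracket L f g = bracket L g f"
  by (simp add: bracket_def mult.commute)

lemma bracket_self_nonneg: "0 \<le> bracket L f f"
  by (simp add: bracket_def)

lemma bracket_cong_AE:
  assumes "f \<in> borel_measurable (leb_interval L)" "f' \<in> borel_measurable (leb_interval L)"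
    "g \<in> borel_measurable (leb_interval L)" "g' \<in> borel_measurable (leb_interval L)"
    and "AE x in leb_interval L. f x = f' x" "AE x in leb_interval L. g x = g' x"
  shows "bracket L f g = bracket L f' g'"
  unfolding bracket_def
proof (rule integral_cong_AE)
  show "AE x in leb_interval L. f x * g x = f' x * g' x"
    using assms(5,6) by eventually_elim simp
qed (use assms in auto)

lemma bracket_expand:
  assumes f: "f \<in> L2_space L" and g: "g \<in> L2_space L"
  shows "bracket L (\<lambda>x. f x + a * g x) (\<lambda>x. f x + a * g x)
    = bracket L f f + 2 * a * bracket L f g + a\<^sup>2 * bracket L g g"
proof -
  have "bracket L (\<lambda>x. f x + a * g x) (\<lambda>x. f x + a * g x)
    = (\<integral>x. f x * f x + 2 * a * (f x * g x) + a\<^sup>2 * (g x * g x) \<partial>leb_interval L)"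
    unfolding bracket_def by (simp add: power2_eq_square algebra_simps)
  then show ?thesis
    using L2_mult_integrable[OF f f] L2_mult_integrable[OF f g] L2_mult_integrable[OF g g]
    by (simp add: bracket_def)
qed

text \<open>
  The square of the norm of \<open>f + l * g\<close> is a nonnegative quadratic polynomial in \<open>l\<close>.
\<close>
lemma bracket_Cauchy_Schwarz:
  assumes f: "f \<in> L2_space L" and g: "g \<in> L2_space L"
  shows "\<bar>bracket L f g\<bar> \<le> sqrt (bracket L f f) * sqrt (bracket L g g)"
proof -
  let ?a = "bracket L f f" and ?b = "bracket L g g" and ?p = "bracket L f g"
  have quad: "0 \<le> ?a + 2 * l * ?p + l\<^sup>2 * ?b" for l
    using bracket_expand[OF f g, of l] bracket_self_nonneg[of L "\<lambda>x. f x + l * g x"] by simp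
  have "?p\<^sup>2 \<le> ?a * ?b"
  proof (cases "?b = 0")
    case True
    have "?p = 0"
    proof (rule ccontr)
      assume "?p \<noteq> 0"
      then show False
        \<comment> \<open>Without a quadratic term the polynomial is affine; here it takes the value \<open>-1\<close>.\<close>
        using quad[of "- (?a + 1) / (2 * ?p)"] True by (simp add: field_simps)
    qed
    then show ?thesis using True by simp
  next
    case False
    then have "?b > 0" using bracket_self_nonneg[of L g] by simp
    \<comment> \<open>The minimizer of the quadratic polynomial.\<close>
    have "0 \<le> ?a + 2 * (- ?p / ?b) * ?p + (- ?p / ?b)\<^sup>2 * ?b" by (rule quad)
    also have "\<dots> = ?a - ?p\<^sup>2 / ?b"
      using \<open>?b > 0\<close> by (simp add: field_simps power2_eq_square)
    finally show ?thesis using \<open>?b > 0\<close> by (simp add: field_simps)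
  qed
  then have "sqrt (?p\<^sup>2) \<le> sqrt (?a * ?b)" by (rule real_sqrt_le_mono)
  then show ?thesis by (simp add: real_sqrt_mult)
qed

section \<open>Weak derivatives and the space \<open>H\<^sup>1\<close>\<close>

lemma has_weak_deriv_lin:
  assumes "f \<in> L2_space L" "f' \<in> L2_space L" "g \<in> L2_space L" "g' \<in> L2_space L"
    and "has_weak_deriv L f f'" "has_weak_deriv L g g'"
  shows "has_weak_deriv L (\<lambda>x. a * f x + b * g x) (\<lambda>x. a * f' x + b * g' x)"
  unfolding has_weak_deriv_def
proof
  fix \<phi> assume \<phi>: "\<phi> \<in> test_functions L"
  show "bracket L (\<lambda>x. a * f x + b * g x) (deriv \<phi>) = - bracket L (\<lambda>x. a * f' x + b * g' x) \<phi>"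
    using assms \<phi> test_function_L2[OF \<phi>] test_function_L2[OF deriv_test_function[OF \<phi>]]
    by (simp add: bracket_lin_left has_weak_deriv_def algebra_simps)
qed

lemma has_weak_deriv_cong_AE:
  assumes "f \<in> borel_measurable (leb_interval L)" "g \<in> borel_measurable (leb_interval L)"
    and "AE x in leb_interval L. f x = g x" "has_weak_deriv L g h"
  shows "has_weak_deriv L f h"
  unfolding has_weak_deriv_def
proof
  fix \<phi> assume \<phi>: "\<phi> \<in> test_functions L"
  have "bracket L f (deriv \<phi>) = bracket L g (deriv \<phi>)"
    by (intro bracket_cong_AE assms test_function_measurable deriv_test_function \<phi>) simp
  then show "bracket L f (deriv \<phi>) = - bracket L h \<phi>"
    using assms(4) \<phi> by (simp add: has_weak_deriv_def)
qed

lemma H1_weak_deriv: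
  assumes "f \<in> H1_space L"
  shows "weak_deriv L f \<in> L2_space L" "has_weak_deriv L f (weak_deriv L f)"
proof -
  have "\<exists>g. g \<in> L2_space L \<and> has_weak_deriv L f g"
    using assms by (auto simp: H1_space_def)
  from someI_ex[OF this] show "weak_deriv L f \<in> L2_space L" "has_weak_deriv L f (weak_deriv L f)"
    by (simp_all add: weak_deriv_def)
qed

lemma H1_L2: "f \<in> H1_space L \<Longrightarrow> f \<in> L2_space L"
  by (simp add: H1_space_def)

text \<open>
  The constant \<^const>\<open>weak_deriv\<close> is an arbitrary choice among weak derivatives. Uniqueness up to null
  sets is what makes it linear up to null sets, and computable from any known weak derivative.
\<close>
lemma has_weak_deriv_unique:
  assumes g: "g \<in> L2_space L" "has_weak_deriv L f g" and h: "h \<in> L2_space L" "has_weak_deriv L f h"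
  shows "AE x in leb_interval L. g x = h x"
proof -
  have "AE x in leb_interval L. 1 * g x + (- 1) * h x = 0"
  proof (rule AE_zero_if_orthogonal_test_functions)
    show "integrable (leb_interval L) (\<lambda>x. 1 * g x + (- 1) * h x)"
      by (intro L2_integrable L2_lin g h)
    fix \<phi> assume \<phi>: "\<phi> \<in> test_functions L"
    show "bracket L (\<lambda>x. 1 * g x + (- 1) * h x) \<phi> = 0"
      unfolding bracket_lin_left[OF g(1) h(1) test_function_L2[OF \<phi>]]
      using g(2) h(2) \<phi> by (simp add: has_weak_deriv_def)
  qed
  then show ?thesis by simp
qed

lemma weak_deriv_AE_eqI:
  assumes "f \<in> L2_space L" "g \<in> L2_space L" "has_weak_deriv L f g"
  shows "f \<in> H1_space L" "AE x in leb_interval L. weak_deriv L f x = g x"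
proof -
  show f: "f \<in> H1_space L" using assms by (auto simp: H1_space_def)
  show "AE x in leb_interval L. weak_deriv L f x = g x"
    by (rule has_weak_deriv_unique[OF H1_weak_deriv[OF f] assms(2,3)])
qed

lemma H1_lin:
  assumes f: "f \<in> H1_space L" and g: "g \<in> H1_space L"
  shows "(\<lambda>x. a * f x + b * g x) \<in> H1_space L"
    and "AE x in leb_interval L. weak_deriv L (\<lambda>x. a * f x + b * g x) x
      = a * weak_deriv L f x + b * weak_deriv L g x"
proof -
  note f' = H1_weak_deriv[OF f] and g' = H1_weak_deriv[OF g]
  note lin = L2_lin[OF H1_L2[OF f] H1_L2[OF g]] L2_lin[OF f'(1) g'(1)]
    has_weak_deriv_lin[OF H1_L2[OF f] f'(1) H1_L2[OF g] g'(1) f'(2) g'(2)]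
  show "(\<lambda>x. a * f x + b * g x) \<in> H1_space L"
    by (rule weak_deriv_AE_eqI(1)[OF lin])
  show "AE x in leb_interval L. weak_deriv L (\<lambda>x. a * f x + b * g x) x
      = a * weak_deriv L f x + b * weak_deriv L g x"
    by (rule weak_deriv_AE_eqI(2)[OF lin])
qed

lemma AE_eq_primitiveD:
  assumes L: "L > 0" and g: "g \<in> L2_space L" and f: "f \<in> borel_measurable (leb_interval L)"
    and eq: "AE x in leb_interval L. f x = primitive L c g x"
  shows "f \<in> H1_space L" "AE x in leb_interval L. weak_deriv L f x = g x"
proof -
  have P: "primitive L c g \<in> L2_space L" by (rule L2_primitive[OF g])
  have "f \<in> L2_space L" by (rule L2_cong_AE[OF f P eq])
  moreover have "has_weak_deriv L f g"
    by (rule has_weak_deriv_cong_AE[OF f L2_measurable[OF P] eq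
          primitive_has_weak_deriv[OF L2_integrable[OF g] L]])
  ultimately show "f \<in> H1_space L" "AE x in leb_interval L. weak_deriv L f x = g x"
    using weak_deriv_AE_eqI g by blast+
qed

text \<open>
  A function and the cumulative integral of its weak derivative have the same weak derivative, so they
  differ by a constant. This is the absolutely continuous representative.
\<close>
lemma H1_AE_eq_primitive:
  assumes L: "L > 0" and f: "f \<in> H1_space L"
  obtains c where "AE x in leb_interval L. f x = primitive L c (weak_deriv L f) x"
proof -
  let ?g = "weak_deriv L f"
  let ?d = "\<lambda>x. 1 * f x + (- 1) * primitive L 0 ?g x"
  have g: "?g \<in> L2_space L" by (rule H1_weak_deriv[OF f])
  have P: "primitive L 0 ?g \<in> L2_space L" by (rule L2_primitive[OF g])
  have "has_weak_deriv L ?d (\<lambda>x. 1 * ?g x + (- 1) * ?g x)"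
    by (intro has_weak_deriv_lin H1_L2 H1_weak_deriv f P primitive_has_weak_deriv L2_integrable L)
  then have weak: "has_weak_deriv L ?d (\<lambda>_. 0)" by simp
  have "integrable (leb_interval L) ?d"
    by (intro L2_integrable L2_lin H1_L2 f P)
  from AE_const_if_weak_deriv_zero[OF L this weak]
  obtain c where "AE x in leb_interval L. ?d x = c" .
  then have "AE x in leb_interval L. f x = primitive L c ?g x"
    by (rule eventually_mono) (auto simp: primitive_def)
  then show thesis by (rule that)
qed

text \<open>
  Boundary values are defined through some continuous representative. This identifies it, end points
  included, with the absolutely continuous one.
\<close>
lemma continuous_AE_eq_imp_eq:
  fixes c p :: "real \<Rightarrow> real"
  assumes L: "L > 0" and c: "continuous_on {-L..L} c" and p: "continuous_on {-L..L} p"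
    and eq: "AE x in leb_interval L. c x = p x" and x: "x \<in> {-L..L}"
  shows "c x = p x"
proof -
  let ?d = "\<lambda>x. \<bar>c x - p x\<bar>"
  have d: "continuous_on {-L..L} ?d" using c p by (intro continuous_intros)
  have meas: "?d \<in> borel_measurable (leb_interval L)"
    by (rule continuous_imp_measurable_on_sets_lebesgue[OF continuous_on_subset[OF d]]) auto
  have AE: "AE x in leb_interval L. ?d x = 0"
    using eq by eventually_elim simp
  have "integrable (leb_interval L) ?d"
    by (rule integrable_cong_AE_imp[of _ "\<lambda>_. 0"]) (use meas AE in auto)
  from has_integral_integral_lebesgue_on[OF this]
  have "(?d has_integral 0) (box (-L) L)"
    using integral_eq_zero_AE[OF AE] by simp
  then have "(?d has_integral 0) (cbox (-L) L)"
    by (simp only: has_integral_open_interval)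
  then have "?d x = 0"
    by (rule has_integral_0_cbox_imp_0[rotated 2]) (use d L x in auto)
  then show ?thesis by simp
qed

lemma H1_boundary_value_primitive:
  assumes L: "L > 0" and f: "f \<in> H1_space L" and bv: "has_boundary_value L f a y" and a: "a \<in> {-L..L}"
  obtains c where "AE x in leb_interval L. f x = primitive L c (weak_deriv L f) x"
    "primitive L c (weak_deriv L f) a = y"
proof -
  obtain c where c: "AE x in leb_interval L. f x = primitive L c (weak_deriv L f) x"
    using H1_AE_eq_primitive[OF L f] .
  obtain p where p: "continuous_on {-L..L} p" "AE x in leb_interval L. p x = f x" "p a = y"
    using bv by (auto simp: has_boundary_value_def)
  have "p a = primitive L c (weak_deriv L f) a"
  proof (rule continuous_AE_eq_imp_eq[OF L p(1) _ _ a])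
    show "continuous_on {-L..L} (primitive L c (weak_deriv L f))"
      by (intro primitive_continuous L2_integrable H1_weak_deriv f)
    show "AE x in leb_interval L. p x = primitive L c (weak_deriv L f) x"
      using p(2) c by eventually_elim simp
  qed
  then show thesis using that[OF c] p(3) by simp
qed

section \<open>Energy conservation\<close>

text \<open>
  With the absolutely continuous representatives \<open>U\<close> of \<open>u\<close> and \<open>R\<close> of \<open>r\<close>, the integrand is
  \<open>U R' R + (U R)' R\<close>, which is the derivative of \<open>U R\<^sup>2\<close>. Its integral vanishes since \<open>U\<close> is zero at
  the left end and \<open>R\<close> at the right end. The term \<open>(U R)'\<close> is available as a weak derivative only once
  \<open>u r\<close> is known to be in \<open>H\<^sup>1\<close>; this holds because \<open>U\<close> and \<open>R\<close> are bounded.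
\<close>
lemma convective_term_cancels:
  assumes L: "L > 0" and u: "u \<in> X1 L" and r: "r \<in> X2 L"
  shows "bracket L (\<lambda>x. u x * weak_deriv L r x + weak_deriv L (\<lambda>y. u y * r y) x) r = 0"
proof -
  let ?M = "leb_interval L" and ?u' = "weak_deriv L u" and ?r' = "weak_deriv L r"
  have uH: "u \<in> H1_space L" and ub: "has_boundary_value L u (-L) 0"
    using u by (auto simp: X1_def)
  have rH: "r \<in> H1_space L" and rb: "has_boundary_value L r L 0"
    using r by (auto simp: X2_def)
  have u': "?u' \<in> L2_space L" and r': "?r' \<in> L2_space L"
    by (intro H1_weak_deriv uH rH)+
  note [measurable] = L2_measurable[OF u'] L2_measurable[OF r'] L2_measurable[OF H1_L2[OF uH]]
    L2_measurable[OF H1_L2[OF rH]]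
  obtain b where "AE x in ?M. u x = primitive L b ?u' x" "primitive L b ?u' (-L) = 0"
    using H1_boundary_value_primitive[OF L uH ub] L by auto
  then have U: "AE x in ?M. u x = primitive L 0 ?u' x"
    by (simp add: primitive_left)
  obtain c where R: "AE x in ?M. r x = primitive L c ?r' x" and R0: "primitive L c ?r' L = 0"
    using H1_boundary_value_primitive[OF L rH rb] L by auto
  define w where "w x = ?u' x * primitive L c ?r' x + primitive L 0 ?u' x * ?r' x" for x
  have "(\<lambda>x. 1 * (?u' x * primitive L c ?r' x) + 1 * (?r' x * primitive L 0 ?u' x)) \<in> L2_space L"
    using u' r'
    by (intro L2_lin L2_bounded_mult[OF _ primitive_measurable primitive_bounded] L2_integrable)
  then have w: "w \<in> L2_space L"
    by (simp add: w_def[abs_def] mult.commute)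
  note [measurable] = L2_measurable[OF w] L2_measurable[OF L2_primitive[OF r']]
    L2_measurable[OF L2_primitive[OF w]]
  have UR: "primitive L 0 ?u' x * primitive L c ?r' x = primitive L 0 w x" for x
    unfolding primitive_mult[OF L2_integrable[OF u'] L2_integrable[OF r']] w_def[abs_def] by simp
  have ur: "AE x in ?M. u x * r x = primitive L 0 w x"
    using U R by eventually_elim (simp add: UR)
  have ur_H1: "(\<lambda>x. u x * r x) \<in> H1_space L"
    and ur': "AE x in ?M. weak_deriv L (\<lambda>x. u x * r x) x = w x"
    by (rule AE_eq_primitiveD[OF L w _ ur]; measurable)+
  note [measurable] = L2_measurable[OF H1_weak_deriv(1)[OF ur_H1]]
  have "bracket L (\<lambda>x. u x * ?r' x + weak_deriv L (\<lambda>y. u y * r y) x) r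
      = (\<integral>x. w x * primitive L c ?r' x + primitive L 0 w x * ?r' x \<partial>?M)"
    unfolding bracket_def
  proof (rule integral_cong_AE)
    show "AE x in ?M. (u x * ?r' x + weak_deriv L (\<lambda>y. u y * r y) x) * r x
        = w x * primitive L c ?r' x + primitive L 0 w x * ?r' x"
      using ur ur' R by eventually_elim (simp add: algebra_simps)
  qed measurable
  also have "\<dots> = primitive L (0 * c) (\<lambda>x. w x * primitive L c ?r' x + primitive L 0 w x * ?r' x) L"
    by (simp add: primitive_right)
  also have "\<dots> = primitive L 0 w L * primitive L c ?r' L"
    by (rule primitive_mult[symmetric]) (intro L2_integrable w r')+
  also have "\<dots> = 0" using R0 by simp
  finally show ?thesis .
qed

lemma energy1_eq_bracket: "energy1 L v = 1 / 2 * bracket L (weak_deriv L v) (weak_deriv L v)"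
  by (simp add: energy1_def bracket_def power2_eq_square)

lemma weak_deriv_norm_le_H1_norm:
  "sqrt (bracket L (weak_deriv L f) (weak_deriv L f)) \<le> H1_norm L f"
  unfolding H1_norm_def using bracket_self_nonneg[of L f] by simp

text \<open>
  The energy is a bounded quadratic form of the weak derivative, hence differentiable along a curve
  that is differentiable in the \<open>H\<^sup>1\<close> norm.
\<close>
lemma energy1_has_derivative:
  assumes v: "\<And>s. s \<in> I \<Longrightarrow> v s \<in> H1_space L" and t: "t \<in> I" and w: "w \<in> H1_space L"
    and deriv: "has_H1_time_deriv L v w t I"
  shows "((\<lambda>s. energy1 L (v s)) has_real_derivative
      bracket L (weak_deriv L (v t)) (weak_deriv L w)) (at t within I)"
proof -
  let ?M = "leb_interval L"
  let ?q = "\<lambda>s x. (v s x - v t x) / (s - t) - w x"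
  let ?N = "\<lambda>s. H1_norm L (?q s)"
  define A where "A = weak_deriv L (v t)"
  define W where "W = weak_deriv L w"
  have A: "A \<in> L2_space L" and W: "W \<in> L2_space L"
    unfolding A_def W_def by (intro H1_weak_deriv v t w)+
  \<comment> \<open>With \<open>D\<close> the weak derivative of the difference quotient minus \<open>w\<close>, the increment of the weak
    derivative of \<open>v\<close> is \<open>(s - t) (W + D)\<close>. Expanding the square leaves \<open>A D\<close> and \<open>(s - t) / 2 (W + D)\<^sup>2\<close>
    as the error of the quotient, and both are controlled by the \<open>H\<^sup>1\<close> norm that bounds \<open>D\<close>.\<close>
  define bound where "bound s = sqrt (bracket L A A) * ?N s
    + \<bar>s - t\<bar> / 2 * (sqrt (bracket L W W) + ?N s)\<^sup>2" for s
  have est: "\<bar>(energy1 L (v s) - energy1 L (v t)) / (s - t) - bracket L A W\<bar> \<le> bound s"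
    if s: "s \<in> I" "s \<noteq> t" for s
  proof -
    define D where "D = weak_deriv L (?q s)"
    let ?k = "1 / (s - t)"
    define Q where "Q = (\<lambda>x. ?k * v s x + (- ?k) * v t x)"
    have Q: "Q \<in> H1_space L"
      and Q': "AE x in ?M. weak_deriv L Q x = ?k * weak_deriv L (v s) x + (- ?k) * A x"
      unfolding Q_def A_def by (intro H1_lin v s t)+
    have q_eq: "?q s = (\<lambda>x. 1 * Q x + (- 1) * w x)"
      by (auto simp: fun_eq_iff Q_def diff_divide_distrib)
    have q: "?q s \<in> H1_space L"
      unfolding q_eq by (intro H1_lin Q w)
    have D: "D \<in> L2_space L"
      unfolding D_def by (rule H1_weak_deriv[OF q])
    have "AE x in ?M. D x = 1 * weak_deriv L Q x + (- 1) * W x"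
      unfolding D_def W_def q_eq by (rule H1_lin[OF Q w])
    then have step: "AE x in ?M. weak_deriv L (v s) x = A x + (s - t) * (W x + 1 * D x)"
      using Q'
    proof eventually_elim
      case (elim x)
      then have "W x + 1 * D x = (weak_deriv L (v s) x - A x) / (s - t)"
        by (simp add: diff_divide_distrib)
      then show ?case using s by simp
    qed
    have WD: "(\<lambda>x. W x + 1 * D x) \<in> L2_space L"
      using L2_lin[OF W D, of 1 1] by simp
    have expand: "bracket L (weak_deriv L (v s)) (weak_deriv L (v s))
        = bracket L A A + 2 * (s - t) * bracket L A (\<lambda>x. W x + 1 * D x)
          + (s - t)\<^sup>2 * bracket L (\<lambda>x. W x + 1 * D x) (\<lambda>x. W x + 1 * D x)"
      unfolding bracket_expand[OF A WD, symmetric]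
      using L2_lin[OF A WD, of 1 "s - t"]
      by (intro bracket_cong_AE step L2_measurable H1_weak_deriv v s) simp_all
    have quotient: "(1 / 2 * (a + 2 * e * p + e\<^sup>2 * q) - 1 / 2 * a) / e = p + e / 2 * q"
      if "e \<noteq> 0" for a e p q :: real
      using that by (simp add: field_simps power2_eq_square)
    have "(energy1 L (v s) - energy1 L (v t)) / (s - t)
        = bracket L A (\<lambda>x. W x + 1 * D x)
          + (s - t) / 2 * bracket L (\<lambda>x. W x + 1 * D x) (\<lambda>x. W x + 1 * D x)"
      unfolding energy1_eq_bracket A_def[symmetric] expand by (rule quotient) (use s in simp)
    moreover have "bracket L A (\<lambda>x. W x + 1 * D x) = bracket L A W + bracket L A D"
      unfolding bracket_sym[of L A "\<lambda>x. W x + 1 * D x"] bracket_sym[of L A W] bracket_sym[of L A D]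
      using bracket_lin_left[OF W D A, of 1 1] by simp
    ultimately have "\<bar>(energy1 L (v s) - energy1 L (v t)) / (s - t) - bracket L A W\<bar>
        = \<bar>bracket L A D + (s - t) / 2 * bracket L (\<lambda>x. W x + 1 * D x) (\<lambda>x. W x + 1 * D x)\<bar>"
      by simp
    also have "\<dots> \<le> \<bar>bracket L A D\<bar>
        + \<bar>s - t\<bar> / 2 * bracket L (\<lambda>x. W x + 1 * D x) (\<lambda>x. W x + 1 * D x)"
      using bracket_self_nonneg[of L "\<lambda>x. W x + 1 * D x"]
      by (intro order_trans[OF abs_triangle_ineq]) (simp add: abs_mult)
    also have "\<dots> \<le> bound s"
      unfolding bound_def
    proof (intro add_mono mult_left_mono)
      have DN: "sqrt (bracket L D D) \<le> ?N s"
        unfolding D_def by (rule weak_deriv_norm_le_H1_norm)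
      have "\<bar>bracket L A D\<bar> \<le> sqrt (bracket L A A) * sqrt (bracket L D D)"
        by (rule bracket_Cauchy_Schwarz[OF A D])
      also have "\<dots> \<le> sqrt (bracket L A A) * ?N s"
        using DN bracket_self_nonneg by (intro mult_left_mono) auto
      finally show "\<bar>bracket L A D\<bar> \<le> sqrt (bracket L A A) * ?N s" .
      have "bracket L (\<lambda>x. W x + 1 * D x) (\<lambda>x. W x + 1 * D x)
          = bracket L W W + 2 * bracket L W D + bracket L D D"
        using bracket_expand[OF W D, of 1] by simp
      also have "\<dots> \<le> (sqrt (bracket L W W) + sqrt (bracket L D D))\<^sup>2"
        using bracket_Cauchy_Schwarz[OF W D] bracket_self_nonneg[of L W] bracket_self_nonneg[of L D]
        by (simp add: power2_sum)
      also have "\<dots> \<le> (sqrt (bracket L W W) + ?N s)\<^sup>2"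
        using DN bracket_self_nonneg by (intro power_mono add_mono add_nonneg_nonneg) auto
      finally show "bracket L (\<lambda>x. W x + 1 * D x) (\<lambda>x. W x + 1 * D x)
          \<le> (sqrt (bracket L W W) + ?N s)\<^sup>2" .
    qed simp
    finally show ?thesis .
  qed
  have "(?N \<longlongrightarrow> 0) (at t within I)"
    using deriv by (simp add: has_H1_time_deriv_def)
  then have "(bound \<longlongrightarrow> sqrt (bracket L A A) * 0
      + \<bar>t - t\<bar> / 2 * (sqrt (bracket L W W) + 0)\<^sup>2) (at t within I)"
    unfolding bound_def by (intro tendsto_intros) simp_all
  then have "(bound \<longlongrightarrow> 0) (at t within I)" by simp
  moreover have "\<forall>\<^sub>F s in at t within I.
      norm ((energy1 L (v s) - energy1 L (v t)) / (s - t) - bracket L A W) \<le> bound s"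
    unfolding eventually_at_filter real_norm_def using est by (intro always_eventually) blast
  ultimately have "((\<lambda>s. (energy1 L (v s) - energy1 L (v t)) / (s - t) - bracket L A W)
      \<longlongrightarrow> 0) (at t within I)"
    by (rule Lim_null_comparison[rotated])
  then show ?thesis
    unfolding has_field_derivative_iff A_def W_def by (rule LIM_zero_cancel)
qed

theorem proposition3:
  fixes L :: real and T :: ereal and I :: "real set"
    and u0 :: "real \<Rightarrow> real"
    and u r ut :: "real \<Rightarrow> real \<Rightarrow> real"
  assumes L_pos: "L > 0"
    and T_pos: "0 < T"
    and I_eq: "I = {t. 0 \<le> t \<and> ereal t < T}"
    and u0_X1: "u0 \<in> X1 L"
    and u_X1: "\<And>t. t \<in> I \<Longrightarrow> u t \<in> X1 L"
    and r_X2: "\<And>t. t \<in> I \<Longrightarrow> r t \<in> X2 L"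
    and initial: "AE x in leb_interval L. u 0 x = u0 x"
    and ut_deriv: "\<And>t. t \<in> I \<Longrightarrow> has_H1_time_deriv L u (ut t) t I"
    and ut_X1: "\<And>t. t \<in> I \<Longrightarrow> ut t \<in> X1 L"
    and weak_eq1: "\<And>t v1. t \<in> I \<Longrightarrow> v1 \<in> X2 L \<Longrightarrow>
        bracket L (weak_deriv L (ut t)) v1 =
        - (1 / 2) * bracket L
          (\<lambda>x. u t x * weak_deriv L (r t) x + weak_deriv L (\<lambda>y. u t y * r t y) x) v1"
    and weak_eq2: "\<And>t v2. t \<in> I \<Longrightarrow> v2 \<in> X1 L \<Longrightarrow>
        bracket L (r t) (weak_deriv L v2) = bracket L (weak_deriv L (u t)) (weak_deriv L v2)"
  shows "\<forall>t\<in>I. ((\<lambda>s. energy1 L (u s)) has_real_derivative 0) (at t within I)"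
proof
  fix t assume t: "t \<in> I"
  have "bracket L (weak_deriv L (u t)) (weak_deriv L (ut t)) = bracket L (r t) (weak_deriv L (ut t))"
    using weak_eq2[OF t ut_X1[OF t]] by simp
  also have "\<dots> = bracket L (weak_deriv L (ut t)) (r t)"
    by (rule bracket_sym)
  also have "\<dots> = 0"
    unfolding weak_eq1[OF t r_X2[OF t]] convective_term_cancels[OF L_pos u_X1[OF t] r_X2[OF t]] by simp
  finally have "bracket L (weak_deriv L (u t)) (weak_deriv L (ut t)) = 0" .
  moreover have "((\<lambda>s. energy1 L (u s)) has_real_derivative
      bracket L (weak_deriv L (u t)) (weak_deriv L (ut t))) (at t within I)"
    using u_X1 ut_X1 t by (intro energy1_has_derivative ut_deriv) (auto simp: X1_def)
  ultimately show "((\<lambda>s. energy1 L (u s)) has_real_derivative 0) (at t within I)"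
    by simp
qed

end
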